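(* Let $X,E\in\mathbb{R}^{p\times p}$ be symmetric matrices, where $X$ has $\mathrm{rank}(X)=r$, spectral decomposition $X=U\Lambda U^\top+U_\perp\Lambda_\perp U_\perp^\top\equiv U\Lambda U^\top$, and leading eigenvalues $|\lambda_1|\ge|\lambda_2|\ge\cdots\ge|\lambda_r|>0$. Let $\hat X=X+E$ and let $\hat U\in\mathbb{R}^{p\times r}$ have as columns orthonormal eigenvectors of $\hat X$ corresponding to its $r$ leading eigenvalues (largest in absolute value). Suppose that $|\lambda_r|\ge4\|E\|_\infty$. Then there exists an $r\times r$ orthogonal matrix $W$ such that $$\|\hat U-UW\|_{2\to\infty}\le14\left(\frac{\|E\|_\infty}{|\lambda_r|}\right)\|U\|_{2\to\infty}.$$
   Context: $\|E\|_\infty:=\max_i\sum_j|e_{ij}|$ is the maximum absolute row sum, and $\|A\|_{2\to\infty}:=\sup_{\|x\|_2=1}\|Ax\|_\infty$ (with the vector $\ell_\infty$ norm on the right). Here $\Lambda=\mathrm{diag}(\lambda_1,\dots,\lambda_r)$, the columns of $U\in\mathbb{R}^{p\times r}$ are orthonormal eigenvectors of $X$ for $\lambda_1,\dots,\lambda_r$, $[U|U_\perp]$ is a $p\times p$ orthogonal matrix, and $\Lambda_\perp=0$ since $\mathrm{rank}(X)=r$. Eigenvalues may be repeated. *)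

theory Defs
  imports "HOL-Analysis.Analysis"
begin

definition max_row_sum :: "real^'n^'m \<Rightarrow> real" where
  "max_row_sum A = Max (range (\<lambda>i. \<Sum>j\<in>UNIV. \<bar>A $ i $ j\<bar>))"

(* infnorm is the vector l_infinity norm, norm the Euclidean one.
   The set of unit vectors is never empty, since index types are nonempty. *)
definition two_to_inf_norm :: "real^'n^'m \<Rightarrow> real" where
  "two_to_inf_norm A = (SUP x\<in>{x. norm x = 1}. infnorm (A *v x))"

definition diag_matrix :: "real^'n \<Rightarrow> real^'n^'n" where
  "diag_matrix d = (\<chi> i j. if i = j then d $ i else 0)"

(* Dimension of the eigenspace. This is 0 when t is not an eigenvalue; for symmetric A it
   agrees with the multiplicity of t as a root of the characteristic polynomial. *)
definition eigenvalue_multiplicity :: "real^'n^'n \<Rightarrow> real \<Rightarrow> nat" where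
  "eigenvalue_multiplicity A t = dim {v. A *v v = t *\<^sub>R v}"

(* l lists, in some order, CARD('r) eigenvalues of A that are largest in absolute value,
   counted with multiplicity: l is a sub-multiset of the eigenvalues of A, and every
   eigenvalue of which some copy is left over is dominated by all entries of l. *)
definition leading_eigenvalues :: "real^'n^'n \<Rightarrow> real^'r \<Rightarrow> bool" where
  "leading_eigenvalues A l \<longleftrightarrow>
     (\<forall>t. card {i. l $ i = t} \<le> eigenvalue_multiplicity A t) \<and>
     (\<forall>t. card {i. l $ i = t} < eigenvalue_multiplicity A t \<longrightarrow> (\<forall>j. \<bar>t\<bar> \<le> \<bar>l $ j\<bar>))"

definition orthonormal_eigenvectors :: "real^'n^'n \<Rightarrow> real^'r \<Rightarrow> real^'r^'n \<Rightarrow> bool" where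
  "orthonormal_eigenvectors A l U \<longleftrightarrow>
     transpose U ** U = mat 1 \<and> (\<forall>j. A *v column j U = l $ j *\<^sub>R column j U)"

end

theory Submission
  imports Defs
begin

text \<open>
  Write \<open>\<rho> = \<bar>\<lambda>\<^sub>r\<bar>\<close>, \<open>\<epsilon>\<close> for the maximal row sum of \<open>E\<close>, and \<open>\<delta> = \<epsilon> / (\<rho> - \<epsilon>)\<close>, which is at most \<open>1/3\<close>.
  For a symmetric matrix the spectral norm is at most the maximal row sum
  (\<open>opnorm_symmetric_le_max_row_sum\<close>), so by a Weyl-type bound (\<open>leading_eigenvalue_lower_bound\<close>) the
  leading eigenvalues of \<open>X + E\<close> have modulus at least \<open>\<rho> - \<epsilon>\<close>. Let \<open>D\<close> be the diagonal matrix of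
  their inverses. The eigenvalue equation reads \<open>Uhat = X Uhat D + Q\<close> with \<open>Q = E Uhat D\<close>. The
  projection \<open>1 - U U\<^sup>T\<close> annihilates \<open>X\<close>, so with \<open>M = U\<^sup>T Uhat\<close>
  one has \<open>R := Uhat - U M = Q - U U\<^sup>T Q\<close>.

  The two-to-infinity norm is submultiplicative against the row-sum norm on the left and against the
  spectral norm on the right. Since \<open>Q\<close> carries \<open>E\<close> on the left and \<open>D\<close> on the right, the
  norm of \<open>R\<close> is at most \<open>\<delta>\<close> times the sum of the norms of \<open>Uhat\<close> and \<open>U\<close>. From \<open>Uhat = R + U M\<close> it
  follows that the norm of \<open>Uhat\<close> is at most twice that of \<open>U\<close>, and so that of \<open>R\<close> at most \<open>3 \<delta>\<close>
  times that of \<open>U\<close>.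

  It remains to replace \<open>M\<close> by an orthogonal matrix. The spectral norm of \<open>R\<close>, the sine of the angle
  between the two column spaces, is at most \<open>\<delta>\<close>, and \<open>1 - M\<^sup>T M = R\<^sup>T R\<close>; so some orthogonal \<open>W\<close> is
  within \<open>\<delta>\<^sup>2 \<le> \<delta> / 3\<close> of \<open>M\<close> (\<open>polar_factor_near\<close>). Altogether the constant is
  \<open>10/3 \<delta> \<le> 40/9 \<epsilon> / \<rho>\<close>, well below \<open>14 \<epsilon> / \<rho>\<close>. Repeated eigenvalues do no harm,
  because only the two column spaces are compared and \<open>W\<close> absorbs the choice of bases.
\<close>

section \<open>The spectral norm\<close>

lemma inner_transpose_left: "(transpose A *v y) \<bullet> x = y \<bullet> (A *v (x::real^'n))"
  for A :: "real^'n^'m"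
  by (simp add: dot_lmul_matrix)

lemma inner_symmetric_matrix:
  fixes A :: "real^'n^'n"
  assumes "transpose A = A"
  shows "(A *v x) \<bullet> y = x \<bullet> (A *v y)"
  using inner_transpose_left[of A x y] assms by simp

lemma transpose_add: "transpose (A + B) = transpose A + transpose (B :: real^'n^'m)"
  by (simp add: transpose_def vec_eq_iff)

abbreviation opnorm :: "real^'n^'m \<Rightarrow> real" where
  "opnorm A \<equiv> onorm ((*v) A)"

lemma opnorm_apply: "norm (A *v x) \<le> opnorm A * norm x"
  by (rule onorm) simp

lemma opnorm_nonneg: "0 \<le> opnorm A" for A :: "real^'n^'m"
  by (rule onorm_pos_le) simp

lemma opnorm_mult_le: "opnorm (A ** B) \<le> opnorm A * opnorm B"
  for A :: "real^'n^'m" and B :: "real^'k^'n"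
proof -
  have "(*v) (A ** B) = (*v) A \<circ> (*v) B"
    by (simp add: fun_eq_iff matrix_vector_mul_assoc)
  then show ?thesis by (simp add: onorm_compose)
qed

lemma opnorm_add_le: "opnorm (A + B) \<le> opnorm A + opnorm B" for A B :: "real^'n^'m"
proof -
  have "(*v) (A + B) = (\<lambda>x. A *v x + B *v x)"
    by (simp add: fun_eq_iff matrix_vector_mult_add_rdistrib)
  then show ?thesis by (simp add: onorm_triangle)
qed

lemma opnorm_scaleR: "opnorm (c *\<^sub>R A) = \<bar>c\<bar> * opnorm A" for A :: "real^'n^'m"
  using onorm_scaleR[of "(*v) A" c] by (simp add: scaleR_matrix_vector_assoc)

lemma opnorm_minus: "opnorm (A - B) = opnorm (B - A)" for A B :: "real^'n^'m"
  using opnorm_scaleR[of "-1" "A - B"] by simp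

lemma opnorm_transpose_le: "opnorm (transpose A) \<le> opnorm A" for A :: "real^'n^'m"
proof (rule onorm_le)
  fix x
  let ?y = "transpose A *v x"
  have "norm ?y * norm ?y = ?y \<bullet> ?y" by (simp add: power2_norm_eq_inner flip: power2_eq_square)
  also have "\<dots> = x \<bullet> (A *v ?y)" by (rule inner_transpose_left)
  also have "\<dots> \<le> norm x * norm (A *v ?y)" by (rule norm_cauchy_schwarz)
  also have "\<dots> \<le> norm x * (opnorm A * norm ?y)"
    by (intro mult_left_mono opnorm_apply) simp
  finally have *: "norm ?y * norm ?y \<le> (opnorm A * norm x) * norm ?y" by (simp add: ac_simps)
  show "norm ?y \<le> opnorm A * norm x"
  proof (cases "norm ?y = 0")
    case True
    then show ?thesis using opnorm_nonneg[of A] by (metis mult_nonneg_nonneg norm_ge_zero)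
  next
    case False
    then show ?thesis using * by (simp del: transpose_matrix_vector)
  qed
qed

text \<open>
  A finite convex function on a Euclidean space is continuous.
\<close>

lemma continuous_on_opnorm: "continuous_on UNIV (opnorm :: real^'n^'m \<Rightarrow> real)"
proof (rule convex_on_continuous)
  show "convex_on UNIV (opnorm :: real^'n^'m \<Rightarrow> real)"
  proof (rule convex_onI)
    fix t :: real and A B :: "real^'n^'m"
    assume "0 < t" "t < 1"
    then show "opnorm ((1 - t) *\<^sub>R A + t *\<^sub>R B) \<le> (1 - t) * opnorm A + t * opnorm B"
      using opnorm_add_le[of "(1 - t) *\<^sub>R A" "t *\<^sub>R B"] by (simp add: opnorm_scaleR)
  qed simp
qed simp

text \<open>
  The ambient norm on matrices is the Frobenius norm. This comparison turns bounds on the spectral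
  norm into boundedness, hence compactness, of sets of matrices.
\<close>

lemma norm_le_opnorm: "norm A \<le> real CARD('m) * opnorm A" for A :: "real^'n^'m"
proof -
  have "norm (A $ i) \<le> opnorm A" for i
  proof -
    have "A $ i = transpose A *v axis i 1"
      by (simp add: matrix_vector_mult_basis column_transpose row_def vec_eq_iff del: transpose_matrix_vector)
    then have "norm (A $ i) \<le> opnorm (transpose A) * 1"
      using opnorm_apply[of "transpose A" "axis i 1"] by (simp del: transpose_matrix_vector)
    then show ?thesis using opnorm_transpose_le[of A] by simp
  qed
  then have "(\<Sum>i\<in>UNIV. norm (A $ i)) \<le> (\<Sum>i\<in>(UNIV::'m set). opnorm A)" by (intro sum_mono)
  moreover have "norm A \<le> (\<Sum>i\<in>UNIV. norm (A $ i))"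
    by (simp add: norm_vec_def L2_set_le_sum)
  ultimately show ?thesis by simp
qed

lemma isometry_preserves:
  fixes U :: "real^'n^'m"
  assumes "transpose U ** U = mat 1"
  shows "(U *v x) \<bullet> (U *v y) = x \<bullet> y" and "norm (U *v x) = norm x"
proof -
  have *: "(U *v x) \<bullet> (U *v y) = x \<bullet> y" for x y
  proof -
    have "(U *v y) \<bullet> (U *v x) = (transpose U *v (U *v y)) \<bullet> x" by (rule inner_transpose_left[symmetric])
    also have "\<dots> = y \<bullet> x" by (simp add: matrix_vector_mul_assoc assms del: transpose_matrix_vector)
    finally show ?thesis by (simp add: inner_commute)
  qed
  then show "(U *v x) \<bullet> (U *v y) = x \<bullet> y" by simp
  show "norm (U *v x) = norm x" by (simp add: norm_eq_sqrt_inner *)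
qed

lemma opnorm_isometry_le:
  fixes U :: "real^'n^'m"
  assumes "transpose U ** U = mat 1"
  shows "opnorm U \<le> 1"
  by (rule onorm_le) (simp add: isometry_preserves[OF assms])

section \<open>Extremal eigenvectors of symmetric matrices\<close>

text \<open>
  A unit vector \<open>v\<close> of \<open>T\<close> that maximises \<open>norm (A *v v)\<close>, with maximum \<open>s\<close>, satisfies
  \<open>A (A v) = s\<^sup>2 v\<close>: expanding the square,
  \<open>norm (A (A v) - s\<^sup>2 v)\<^sup>2 = norm (A (A v))\<^sup>2 - 2 s\<^sup>2 norm (A v)\<^sup>2 + s\<^sup>4\<close>, and the first term is at
  most \<open>s\<^sup>4\<close> because \<open>A v\<close> lies in \<open>T\<close> again. As \<open>(A - s) (A + s) v = 0\<close>, either \<open>v\<close> is an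
  eigenvector for \<open>- s\<close> or \<open>A v + s v\<close> is one for \<open>s\<close>. This is the only spectral information on
  symmetric matrices that the perturbation bound needs: with \<open>T = UNIV\<close> it compares the spectral norm
  with the row-sum norm, with \<open>T\<close> an orthogonal complement of eigenvectors it yields Weyl's bound.
\<close>

lemma symmetric_extremal_eigenvector:
  fixes A :: "real^'n^'n"
  assumes sym: "transpose A = A" and T: "subspace T" and inv: "\<And>x. x \<in> T \<Longrightarrow> A *v x \<in> T"
    and x0: "x0 \<in> T" "x0 \<noteq> 0"
  obtains t y where "y \<in> T" "y \<noteq> 0" "A *v y = t *\<^sub>R y"
    and "\<And>x. x \<in> T \<Longrightarrow> norm (A *v x) \<le> \<bar>t\<bar> * norm x"
proof -
  define K where "K = T \<inter> sphere 0 1"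
  have "compact K" unfolding K_def by (intro closed_Int_compact closed_subspace T compact_sphere)
  moreover have "x0 /\<^sub>R norm x0 \<in> K" unfolding K_def using x0 T by (simp add: subspace_scale)
  moreover have "continuous_on K (\<lambda>x. norm (A *v x))"
    by (intro continuous_on_norm linear_continuous_on) simp
  ultimately obtain v where v: "v \<in> K" and vmax: "\<And>x. x \<in> K \<Longrightarrow> norm (A *v x) \<le> norm (A *v v)"
    using continuous_attains_sup[of K "\<lambda>x. norm (A *v x)"] by blast
  define s where "s = norm (A *v v)"
  have vT: "v \<in> T" and nv: "norm v = 1" using v by (auto simp: K_def)
  have s0: "0 \<le> s" by (simp add: s_def)
  have bound: "norm (A *v x) \<le> s * norm x" if "x \<in> T" for x
  proof (cases "x = 0")
    case False
    then have "x /\<^sub>R norm x \<in> K" unfolding K_def using that T by (simp add: subspace_scale)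
    from vmax[OF this] have "norm (A *v x) / norm x \<le> s"
      by (simp add: s_def matrix_vector_mult_scaleR divide_inverse_commute)
    then show ?thesis using False by (simp add: divide_le_eq)
  qed simp
  define z where "z = A *v (A *v v)"
  have "norm z \<le> s * s"
    using bound[OF inv[OF vT]] by (simp add: z_def s_def)
  then have "z \<bullet> z \<le> (s * s)\<^sup>2"
    by (metis norm_ge_zero power2_norm_eq_inner power_mono)
  moreover have "z \<bullet> v = s\<^sup>2"
    using inner_symmetric_matrix[OF sym, of "A *v v" v] by (simp add: z_def s_def power2_norm_eq_inner)
  moreover have "v \<bullet> v = 1" using nv by (simp add: norm_eq_1)
  ultimately have "(z - s\<^sup>2 *\<^sub>R v) \<bullet> (z - s\<^sup>2 *\<^sub>R v) \<le> 0"
    by (simp add: inner_diff_left inner_diff_right inner_commute power2_eq_square)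
  then have zv: "z = s\<^sup>2 *\<^sub>R v"
    by (metis eq_iff_diff_eq_0 inner_gt_zero_iff not_le)
  define w where "w = A *v v + s *\<^sub>R v"
  show ?thesis
  \<comment> \<open>Here \<open>w = (A + s) v\<close> is annihilated by \<open>A - s\<close>.\<close>
  proof (cases "w = 0")
    case True
    then have "A *v v = (- s) *\<^sub>R v" by (simp add: w_def add_eq_0_iff)
    then show ?thesis using that[of v "- s"] vT nv bound s0 by force
  next
    case False
    have "A *v w = s *\<^sub>R w"
      using zv by (simp add: w_def z_def matrix_vector_right_distrib matrix_vector_mult_scaleR
          scaleR_add_right power2_eq_square add.commute)
    moreover have "w \<in> T" unfolding w_def using vT inv T by (simp add: subspace_add subspace_scale)
    ultimately show ?thesis using that[of w s] False bound s0 by auto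
  qed
qed

section \<open>The row-sum norm and the two-to-infinity norm\<close>

lemma row_sum_le_max_row_sum: "(\<Sum>j\<in>UNIV. \<bar>A $ i $ j\<bar>) \<le> max_row_sum A"
  unfolding max_row_sum_def by (rule Max_ge) auto

lemma max_row_sum_nonneg: "0 \<le> max_row_sum A"
  by (rule order_trans[OF _ row_sum_le_max_row_sum]) (simp add: sum_nonneg)

lemma infnorm_le_cart:
  fixes x :: "real^'n"
  assumes "\<And>i. \<bar>x $ i\<bar> \<le> b"
  shows "infnorm x \<le> b"
  unfolding infnorm_cart by (rule cSup_least) (use assms in auto)

lemma infnorm_max_row_sum: "infnorm (A *v x) \<le> max_row_sum A * infnorm x"
  for A :: "real^'n^'m"
proof (rule infnorm_le_cart)
  fix i
  have "\<bar>(A *v x) $ i\<bar> \<le> (\<Sum>j\<in>UNIV. \<bar>A $ i $ j\<bar> * \<bar>x $ j\<bar>)"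
    by (simp add: matrix_vector_mult_def sum_abs flip: abs_mult)
  also have "\<dots> \<le> (\<Sum>j\<in>UNIV. \<bar>A $ i $ j\<bar> * infnorm x)"
    by (intro sum_mono mult_left_mono component_le_infnorm_cart) simp
  also have "\<dots> \<le> max_row_sum A * infnorm x"
    unfolding sum_distrib_right[symmetric]
    by (intro mult_right_mono row_sum_le_max_row_sum infnorm_pos_le)
  finally show "\<bar>(A *v x) $ i\<bar> \<le> max_row_sum A * infnorm x" .
qed

text \<open>
  The spectral norm of a symmetric matrix is \<open>\<bar>t\<bar>\<close> for some eigenvalue \<open>t\<close>, and an eigenvector for \<open>t\<close>
  is stretched by \<open>\<bar>t\<bar>\<close> in the maximum norm as well, whose induced matrix norm is the maximal row sum.
\<close>

lemma opnorm_symmetric_le_max_row_sum: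
  fixes A :: "real^'n^'n"
  assumes "transpose A = A"
  shows "opnorm A \<le> max_row_sum A"
proof -
  have "(axis undefined 1 :: real^'n) \<noteq> 0" by (simp add: axis_eq_0_iff)
  then obtain t y where y: "y \<noteq> 0" "A *v y = t *\<^sub>R y"
    and bd: "\<And>x. norm (A *v x) \<le> \<bar>t\<bar> * norm x"
    using symmetric_extremal_eigenvector[OF assms subspace_UNIV] by (metis UNIV_I)
  have "\<bar>t\<bar> * infnorm y \<le> max_row_sum A * infnorm y"
    using infnorm_max_row_sum[of A y] y by (simp add: infnorm_mul)
  then have "\<bar>t\<bar> \<le> max_row_sum A" using y(1) infnorm_pos_lt[of y] by simp
  moreover have "opnorm A \<le> \<bar>t\<bar>" using bd by (rule onorm_le)
  ultimately show ?thesis by simp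
qed

lemma two_to_inf_bdd: "bdd_above ((\<lambda>x. infnorm (A *v x)) ` {x. norm x = 1})"
  for A :: "real^'n^'m"
proof (rule bdd_aboveI2)
  fix x :: "real^'n" assume "x \<in> {x. norm x = 1}"
  then show "infnorm (A *v x) \<le> opnorm A"
    using infnorm_le_norm[of "A *v x"] opnorm_apply[of A x] by simp
qed

lemma infnorm_two_to_inf: "infnorm (A *v x) \<le> two_to_inf_norm A * norm x"
  for A :: "real^'n^'m"
proof (cases "x = 0")
  case False
  have "infnorm (A *v (x /\<^sub>R norm x)) \<le> two_to_inf_norm A"
    unfolding two_to_inf_norm_def by (rule cSUP_upper) (use False two_to_inf_bdd in auto)
  then show ?thesis using False
    by (simp add: matrix_vector_mult_scaleR infnorm_mul divide_le_eq inverse_eq_divide)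
qed (simp add: infnorm_0)

lemma two_to_inf_le:
  fixes A :: "real^'n^'m"
  assumes "\<And>x. infnorm (A *v x) \<le> b * norm x"
  shows "two_to_inf_norm A \<le> b"
  unfolding two_to_inf_norm_def
proof (rule cSUP_least)
  show "{x::real^'n. norm x = 1} \<noteq> {}" using norm_axis_1 by blast
  show "infnorm (A *v x) \<le> b" if "x \<in> {x. norm x = 1}" for x using assms[of x] that by simp
qed

lemma two_to_inf_nonneg: "0 \<le> two_to_inf_norm A" for A :: "real^'n^'m"
  using infnorm_two_to_inf[of A "axis undefined 1"] infnorm_pos_le[of "A *v axis undefined 1"] by simp

lemma two_to_inf_add_le: "two_to_inf_norm (A + B) \<le> two_to_inf_norm A + two_to_inf_norm B"
  for A B :: "real^'n^'m"
proof (rule two_to_inf_le)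
  fix x
  show "infnorm ((A + B) *v x) \<le> (two_to_inf_norm A + two_to_inf_norm B) * norm x"
    using infnorm_triangle[of "A *v x" "B *v x"] infnorm_two_to_inf[of A x] infnorm_two_to_inf[of B x]
    by (simp add: matrix_vector_mult_add_rdistrib distrib_right)
qed

lemma two_to_inf_mult_opnorm: "two_to_inf_norm (A ** B) \<le> two_to_inf_norm A * opnorm B"
  for A :: "real^'n^'m" and B :: "real^'k^'n"
proof (rule two_to_inf_le)
  fix x
  have "infnorm (A *v (B *v x)) \<le> two_to_inf_norm A * norm (B *v x)" by (rule infnorm_two_to_inf)
  also have "\<dots> \<le> two_to_inf_norm A * (opnorm B * norm x)"
    by (intro mult_left_mono opnorm_apply two_to_inf_nonneg)
  finally show "infnorm ((A ** B) *v x) \<le> two_to_inf_norm A * opnorm B * norm x"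
    by (simp add: matrix_vector_mul_assoc)
qed

lemma two_to_inf_max_row_sum_mult: "two_to_inf_norm (A ** B) \<le> max_row_sum A * two_to_inf_norm B"
  for A :: "real^'n^'m" and B :: "real^'k^'n"
proof (rule two_to_inf_le)
  fix x
  have "infnorm (A *v (B *v x)) \<le> max_row_sum A * infnorm (B *v x)" by (rule infnorm_max_row_sum)
  also have "\<dots> \<le> max_row_sum A * (two_to_inf_norm B * norm x)"
    by (intro mult_left_mono infnorm_two_to_inf max_row_sum_nonneg)
  finally show "infnorm ((A ** B) *v x) \<le> max_row_sum A * two_to_inf_norm B * norm x"
    by (simp add: matrix_vector_mul_assoc)
qed

lemma two_to_inf_minus: "two_to_inf_norm (- A) = two_to_inf_norm A" for A :: "real^'n^'m"
proof -
  have "(- A) *v x = - (A *v x)" for x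
    using matrix_vector_mult_diff_rdistrib[of 0 A x] by simp
  then show ?thesis by (simp add: two_to_inf_norm_def infnorm_neg)
qed

section \<open>Orthogonal matrices near an almost orthogonal matrix\<close>

text \<open>
  The orthogonal polar factor of \<open>M\<close>, found without singular values or matrix square roots. Write
  \<open>H W = mat 1 - transpose W ** W\<close> for the defect of orthogonality. The Newton-Schulz step
  \<open>V = W (1 + H W / 2)\<close> has defect \<open>3/4 (H W)\<^sup>2 + 1/4 (H W)\<^sup>3\<close>, which is quadratically small, while it
  moves \<open>W\<close> by only about \<open>opnorm (H W) / 2\<close>. Hence the step strictly decreases
  \<open>f W = opnorm (W - M) + opnorm (H W)\<close> as long as the defect is small and nonzero. The function \<open>f\<close>
  attains a minimum, by compactness of its sublevel sets; a minimiser has small defect, since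
  \<open>f M = opnorm (H M)\<close>, so it must be orthogonal, and its distance to \<open>M\<close> is at most \<open>f M\<close>.
  In singular values this is the estimate \<open>1 - \<sigma> \<le> 1 - \<sigma>\<^sup>2\<close>.
\<close>

lemma polar_factor_near:
  fixes M :: "real^'n^'n"
  assumes small: "opnorm (mat 1 - transpose M ** M) \<le> 1/9"
  obtains W where "orthogonal_matrix W" and "opnorm (M - W) \<le> opnorm (mat 1 - transpose M ** M)"
proof -
  define H :: "real^'n^'n \<Rightarrow> real^'n^'n" where "H W = mat 1 - transpose W ** W" for W
  define f where "f W = opnorm (W - M) + opnorm (H W)" for W
  have "continuous_on UNIV H"
  proof -
    have "H = (\<lambda>W. \<chi> i j. (if i = j then 1 else 0) - (\<Sum>k\<in>UNIV. W $ k $ i * W $ k $ j))"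
      by (simp add: H_def fun_eq_iff vec_eq_iff mat_def matrix_matrix_mult_def transpose_def)
    then show ?thesis by (auto intro!: continuous_intros)
  qed
  then have cont: "continuous_on UNIV f"
    unfolding f_def
    by (intro continuous_on_add continuous_on_compose2[OF continuous_on_opnorm]) (auto intro!: continuous_intros)
  define S where "S = {W. f W \<le> f M}"
  have "closed S"
    unfolding S_def by (intro closed_Collect_le cont continuous_on_const)
  moreover have "bounded S"
  proof (rule boundedI)
    fix W assume "W \<in> S"
    then have "opnorm (W - M) \<le> f M" using opnorm_nonneg[of "H W"] by (simp add: S_def f_def)
    then have "opnorm W \<le> f M + opnorm M" using opnorm_add_le[of "W - M" M] by simp
    then show "norm W \<le> real CARD('n) * (f M + opnorm M)"
      by (intro order_trans[OF norm_le_opnorm] mult_left_mono) simp_all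
  qed
  ultimately have "compact S" by (simp add: compact_eq_bounded_closed)
  moreover have "M \<in> S" by (simp add: S_def)
  ultimately obtain W where WS: "W \<in> S" and Wmin: "\<And>V. V \<in> S \<Longrightarrow> f W \<le> f V"
    using continuous_attains_inf[of S f] cont continuous_on_subset by blast
  define \<eta> where "\<eta> = opnorm (H W)"
  have \<eta>0: "0 \<le> \<eta>" by (simp add: \<eta>_def opnorm_nonneg)
  have fW: "f W \<le> opnorm (H M)" using WS by (simp add: S_def f_def onorm_eq_0[THEN iffD2])
  have \<eta>1: "\<eta> \<le> 1/9"
    using fW small opnorm_nonneg[of "W - M"] by (simp add: f_def \<eta>_def H_def)
  have sH: "transpose (H W) = H W"
    by (simp add: H_def transpose_def vec_eq_iff mat_def matrix_matrix_mult_def mult.commute)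
  have "\<eta> = 0"
  proof (rule ccontr)
    assume "\<eta> \<noteq> 0"
    define h where "h = H W"
    define V where "V = W ** (mat 1 + (1/2) *\<^sub>R h)"
    have WW: "transpose W *v (W *v x) = x - h *v x" for x
      by (simp add: h_def H_def matrix_vector_mult_diff_rdistrib matrix_vector_mul_assoc
          del: transpose_matrix_vector)
    have V: "V *v x = W *v (x + (1/2) *\<^sub>R (h *v x))" for x
      by (simp add: V_def matrix_vector_mult_add_rdistrib scaleR_matrix_vector_assoc
          flip: matrix_vector_mul_assoc)
    have tV: "transpose V = (mat 1 + (1/2) *\<^sub>R h) ** transpose W"
      using sH by (simp add: V_def matrix_transpose_mul transpose_add transpose_mat transpose_scalar h_def)
    have tV': "transpose V *v x = transpose W *v x + (1/2) *\<^sub>R (h *v (transpose W *v x))" for x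
      by (simp add: tV matrix_vector_mult_add_rdistrib scaleR_matrix_vector_assoc
          del: transpose_matrix_vector flip: matrix_vector_mul_assoc)
    have HV: "H V = (3/4) *\<^sub>R (h ** h) + (1/4) *\<^sub>R (h ** (h ** h))"
    proof (subst matrix_eq, intro allI)
      fix x
      have "H V *v x = x - transpose V *v (V *v x)"
        by (simp add: H_def matrix_vector_mult_diff_rdistrib matrix_vector_mul_assoc
            del: transpose_matrix_vector)
      also have "\<dots> = (3/4) *\<^sub>R (h *v (h *v x)) + (1/4) *\<^sub>R (h *v (h *v (h *v x)))"
        unfolding V tV' WW
        by (simp add: matrix_vector_right_distrib matrix_vector_mult_diff_distrib matrix_vector_mult_scaleR vec_eq_iff field_simps)
      also have "\<dots> = ((3/4) *\<^sub>R (h ** h) + (1/4) *\<^sub>R (h ** (h ** h))) *v x"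
        by (simp add: matrix_vector_mult_add_rdistrib flip: scaleR_matrix_vector_assoc matrix_vector_mul_assoc)
      finally show "H V *v x = ((3/4) *\<^sub>R (h ** h) + (1/4) *\<^sub>R (h ** (h ** h))) *v x" .
    qed
    have h2: "opnorm (h ** h) \<le> \<eta> * \<eta>" using opnorm_mult_le[of h h] by (simp add: h_def \<eta>_def)
    have h3: "opnorm (h ** (h ** h)) \<le> \<eta> * (\<eta> * \<eta>)"
      using opnorm_mult_le[of h "h ** h"] h2 \<eta>0 mult_left_mono[OF h2 \<eta>0] by (simp add: h_def \<eta>_def)
    have "opnorm (H V) \<le> 3/4 * (\<eta> * \<eta>) + 1/4 * (\<eta> * (\<eta> * \<eta>))"
      unfolding HV
      using opnorm_add_le[of "(3/4) *\<^sub>R (h ** h)" "(1/4) *\<^sub>R (h ** (h ** h))"] h2 h3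
      by (simp add: opnorm_scaleR)
    moreover have "\<eta> * \<eta> \<le> \<eta> * (1/9)" using \<eta>0 \<eta>1 by (intro mult_left_mono)
    moreover have "\<eta> * (\<eta> * \<eta>) \<le> \<eta> * \<eta>" using \<eta>0 \<eta>1 by (intro mult_left_mono) (auto intro: mult_left_le)
    ultimately have HVle: "opnorm (H V) \<le> \<eta> / 9" by simp
    have "opnorm W \<le> 4/3"
    proof (rule onorm_le)
      fix x
      have "(W *v x) \<bullet> (W *v x) = x \<bullet> x - (h *v x) \<bullet> x"
        using inner_transpose_left[of W "W *v x" x] by (simp add: WW inner_diff_left del: transpose_matrix_vector)
      moreover have "\<bar>(h *v x) \<bullet> x\<bar> \<le> \<eta> * norm x * norm x"
        using Cauchy_Schwarz_ineq2[of "h *v x" x] opnorm_apply[of h x]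
        by (smt (verit) \<eta>_def h_def mult_right_mono norm_ge_zero)
      moreover have "\<eta> * norm x * norm x \<le> (1/9) * norm x * norm x"
        using \<eta>1 by (intro mult_right_mono) auto
      ultimately have "(norm (W *v x))\<^sup>2 \<le> 10/9 * (norm x)\<^sup>2"
        by (simp add: power2_norm_eq_inner[symmetric] power2_eq_square)
      also have "\<dots> \<le> (4/3 * norm x)\<^sup>2" by (simp add: power_mult_distrib power2_eq_square)
      finally show "norm (W *v x) \<le> 4/3 * norm x" by (rule power2_le_imp_le) simp
    qed
    then have "opnorm W * \<eta> \<le> 4/3 * \<eta>" using \<eta>0 by (intro mult_right_mono)
    moreover have "V - W = (1/2) *\<^sub>R (W ** h)"
      by (simp add: V_def matrix_add_ldistrib matrix_scalar_ac scalar_matrix_assoc)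
    ultimately have VW: "opnorm (V - W) \<le> 2/3 * \<eta>"
      using opnorm_mult_le[of W h] by (simp add: opnorm_scaleR h_def \<eta>_def)
    have "opnorm (V - M) \<le> opnorm (V - W) + opnorm (W - M)"
      using opnorm_add_le[of "V - W" "W - M"] by simp
    then have "f V < f W" using HVle VW \<eta>0 \<open>\<eta> \<noteq> 0\<close> by (simp add: f_def \<eta>_def)
    moreover have "V \<in> S" using calculation WS by (simp add: S_def)
    ultimately show False using Wmin[of V] by simp
  qed
  then have "\<forall>x. H W *v x = 0" by (simp add: \<eta>_def onorm_eq_0)
  then have "H W = 0" by (simp add: matrix_eq)
  then have "orthogonal_matrix W" by (simp add: H_def orthogonal_matrix)
  moreover have "opnorm (M - W) \<le> opnorm (mat 1 - transpose M ** M)"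
    using fW \<open>\<eta> = 0\<close> opnorm_minus[of M W] by (simp add: f_def \<eta>_def H_def)
  ultimately show ?thesis by (rule that)
qed

section \<open>A lower bound for leading eigenvalues\<close>

text \<open>
  The lower half of the Courant-Fischer principle, stated with multiplicities: if \<open>A\<close> stretches
  every vector of an \<open>r\<close>-dimensional subspace, the range of \<open>B\<close>, by at least \<open>c\<close>, then its \<open>r\<close> leading
  eigenvalues have modulus at least \<open>c\<close>. If \<open>\<bar>l $ j\<bar> < c\<close>, then fewer than \<open>r\<close> columns of \<open>V\<close>
  belong to eigenvalues of modulus at least \<open>c\<close>, so some nonzero vector of the range of \<open>B\<close> is
  orthogonal to all of them. On their orthogonal complement \<open>T\<close> there is then an eigenvector \<open>y\<close>
  whose eigenvalue \<open>t\<close> has modulus at least \<open>c\<close>. As \<open>t\<close> is larger in modulus than \<open>l $ j\<close>, no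
  copy of \<open>t\<close> is missing from \<open>l\<close>, so the columns of \<open>V\<close> for \<open>t\<close> span its whole eigenspace;
  thus \<open>y\<close> is a combination of vectors to which it is orthogonal.
\<close>

lemma leading_eigenvalue_lower_bound:
  fixes A :: "real^'n^'n" and V B :: "real^'r^'n"
  assumes sym: "transpose A = A" and lead: "leading_eigenvalues A l"
    and eig: "orthonormal_eigenvectors A l V" and B: "transpose B ** B = mat 1"
    and below: "\<And>w. c * norm w \<le> norm (A *v (B *v w))"
  shows "c \<le> \<bar>l $ j\<bar>"
proof (rule ccontr)
  assume "\<not> c \<le> \<bar>l $ j\<bar>"
  then have jc: "\<bar>l $ j\<bar> < c" by simp
  let ?v = "\<lambda>i. column i V"
  have Av: "A *v ?v i = l $ i *\<^sub>R ?v i" for i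
    using eig by (simp add: orthonormal_eigenvectors_def)
  have "transpose V ** V = mat 1" using eig by (simp add: orthonormal_eigenvectors_def)
  then have orth: "?v i \<bullet> ?v k = (if i = k then 1 else 0)" for i k
    by (simp add: matrix_mult_transpose_dot_column mat_def vec_eq_iff)
  define I where "I = {i. c \<le> \<bar>l $ i\<bar>}"
  define T where "T = {x. \<forall>i\<in>I. ?v i \<bullet> x = 0}"
  have T: "subspace T" by (auto simp: T_def subspace_def inner_add_right)
  have inv: "A *v x \<in> T" if "x \<in> T" for x
    using that by (simp add: T_def Av inner_symmetric_matrix[OF sym, symmetric])
  define g where "g w = (\<chi> i. if i \<in> I then ?v i \<bullet> (B *v w) else 0)" for w
  have lin: "linear g"
    by (rule linearI) (simp_all add: g_def vec_eq_iff matrix_vector_right_distrib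
        matrix_vector_mult_scaleR inner_add_right)
  \<comment> \<open>Coordinate \<open>j\<close> of \<open>g\<close> vanishes identically, so this endomorphism is not surjective.\<close>
  have "\<not> inj g"
  proof
    assume "inj g"
    then have "surj g" by (simp add: linear_injective_imp_surjective[OF lin])
    then obtain w where "axis j 1 = g w" by (metis surjD)
    then have "(axis j 1 :: real^'r) $ j = g w $ j" by simp
    then show False using jc by (simp add: g_def I_def)
  qed
  then obtain w where w: "w \<noteq> 0" "g w = 0" using linear_injective_0[OF lin] by blast
  have nw: "norm (B *v w) = norm w" by (rule isometry_preserves[OF B])
  have "?v i \<bullet> (B *v w) = 0" if "i \<in> I" for i
    using w(2) that by (simp add: g_def vec_eq_iff) metis
  then have BwT: "B *v w \<in> T" by (simp add: T_def)
  moreover have "B *v w \<noteq> 0" using nw w(1) by force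
  ultimately obtain t y where y: "y \<in> T" "y \<noteq> 0" "A *v y = t *\<^sub>R y"
    and bd: "\<And>x. x \<in> T \<Longrightarrow> norm (A *v x) \<le> \<bar>t\<bar> * norm x"
    using symmetric_extremal_eigenvector[OF sym T inv] by blast
  have "c * norm w \<le> \<bar>t\<bar> * norm w" using bd[OF BwT] below[of w] nw by simp
  then have ct: "c \<le> \<bar>t\<bar>" using w(1) by simp
  define J where "J = {i. l $ i = t}"
  have JI: "J \<subseteq> I" using ct by (auto simp: J_def I_def)
  have "\<not> card J < eigenvalue_multiplicity A t"
    using lead jc ct unfolding leading_eigenvalues_def J_def
    by (metis leD order_less_le_trans)
  then have dimle: "dim {x. A *v x = t *\<^sub>R x} \<le> card J" by (simp add: eigenvalue_multiplicity_def)
  have inj: "inj_on ?v J" by (rule inj_onI) (metis (full_types) orth zero_neq_one)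
  have "independent (?v ` J)"
  proof (rule pairwise_orthogonal_independent)
    show "pairwise orthogonal (?v ` J)" by (auto simp: pairwise_def orthogonal_def orth)
    have "?v i \<noteq> 0" for i using orth[of i i] by auto
    then show "0 \<notin> ?v ` J" by (simp add: image_iff)
  qed
  moreover have "?v ` J \<subseteq> {x. A *v x = t *\<^sub>R x}" by (auto simp: J_def Av)
  ultimately have "{x. A *v x = t *\<^sub>R x} \<subseteq> span (?v ` J)"
    using dimle card_image[OF inj] by (intro card_ge_dim_independent) auto
  then have "y \<in> span (?v ` J)" using y by blast
  moreover have "orthogonal y x" if "x \<in> ?v ` J" for x
    using y(1) JI that by (auto simp: T_def orthogonal_def inner_commute)
  ultimately have "orthogonal y y" using orthogonal_to_span by blast
  then show False using y(2) by (simp add: orthogonal_def)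
qed

section \<open>Diagonal matrices and projections\<close>

lemma diag_matrix_mult_vec: "(diag_matrix d *v x) $ i = d $ i * x $ i"
  by (simp add: diag_matrix_def matrix_vector_mult_def if_distrib[where f="\<lambda>z. z * _"] cong: if_cong)

lemma diag_matrix_norm_ge:
  assumes "\<And>i. c \<le> \<bar>d $ i\<bar>" and "0 \<le> c"
  shows "c * norm x \<le> norm (diag_matrix d *v x)"
proof -
  have "norm (c *\<^sub>R x) \<le> norm (diag_matrix d *v x)"
    by (rule norm_le_componentwise_cart)
      (use assms in \<open>simp add: diag_matrix_mult_vec abs_mult mult_right_mono\<close>)
  then show ?thesis using assms(2) by simp
qed

lemma opnorm_diag_matrix_le:
  assumes "\<And>i. \<bar>d $ i\<bar> \<le> c"
  shows "opnorm (diag_matrix d) \<le> c"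
proof (rule onorm_le)
  fix x
  have c: "0 \<le> c" using assms by (meson abs_ge_zero order_trans)
  have "norm (diag_matrix d *v x) \<le> norm (c *\<^sub>R x)"
    by (rule norm_le_componentwise_cart)
      (use assms c in \<open>simp add: diag_matrix_mult_vec abs_mult mult_right_mono\<close>)
  then show "norm (diag_matrix d *v x) \<le> c * norm x" using c by simp
qed

lemma eigenvectors_diagonalise:
  assumes "orthonormal_eigenvectors A l V" and "\<And>i. l $ i \<noteq> 0"
  shows "A ** V ** diag_matrix (\<chi> i. 1 / l $ i) = V"
proof (subst matrix_eq, intro allI)
  fix x
  let ?y = "diag_matrix (\<chi> i. 1 / l $ i) *v x"
  have "A ** V ** diag_matrix (\<chi> i. 1 / l $ i) *v x = A *v (V *v ?y)"
    by (simp add: matrix_vector_mul_assoc matrix_mul_assoc)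
  also have "V *v ?y = (\<Sum>i\<in>UNIV. ?y $ i *\<^sub>R column i V)"
    by (simp add: matrix_mult_sum scalar_mult_eq_scaleR)
  also have "A *v \<dots> = (\<Sum>i\<in>UNIV. (?y $ i * l $ i) *\<^sub>R column i V)"
    using assms(1) by (simp add: orthonormal_eigenvectors_def linear_sum[OF matrix_vector_mul_linear] matrix_vector_mult_scaleR)
  also have "\<dots> = (\<Sum>i\<in>UNIV. x $ i *\<^sub>R column i V)"
    using assms(2) by (simp add: diag_matrix_mult_vec)
  also have "\<dots> = V *v x"
    by (simp add: matrix_mult_sum scalar_mult_eq_scaleR)
  finally show "A ** V ** diag_matrix (\<chi> i. 1 / l $ i) *v x = V *v x" .
qed

text \<open>
  \<open>1 - U U\<^sup>T\<close> is a symmetric idempotent, the orthogonal projection onto the complement of the range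
  of \<open>U\<close>.
\<close>

lemma projection_complement_inner:
  fixes U :: "real^'r^'n"
  assumes "transpose U ** U = mat 1"
  shows "(x - U *v (transpose U *v x)) \<bullet> (y - U *v (transpose U *v y)) =
    x \<bullet> y - (transpose U *v x) \<bullet> (transpose U *v y)"
proof -
  have adj: "a \<bullet> (U *v b) = (transpose U *v a) \<bullet> b" "(U *v b) \<bullet> a = b \<bullet> (transpose U *v a)" for a b
    using inner_transpose_left[of U a b] by (simp_all add: inner_commute)
  have "(U *v (transpose U *v x)) \<bullet> (U *v (transpose U *v y)) = (transpose U *v x) \<bullet> (transpose U *v y)"
    by (rule isometry_preserves(1)[OF assms])
  then show ?thesis
    unfolding inner_diff_left inner_diff_right adj(1)[of x] adj(2)[of _ y] by simp
qed

section \<open>Perturbation of the leading eigenvectors\<close>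

theorem theorem4p2:
  fixes X E :: "real^'p^'p"
    and U Uhat :: "real^'r::{finite,linorder}^'p"
    and lam lamhat :: "real^'r::{finite,linorder}"
  assumes "transpose X = X" and "transpose E = E"
    and "rank X = CARD('r)"
    and "orthonormal_eigenvectors X lam U"
    and "X = U ** diag_matrix lam ** transpose U"
    and "leading_eigenvalues X lam"
    and "\<And>i j. i \<le> j \<Longrightarrow> \<bar>lam $ i\<bar> \<ge> \<bar>lam $ j\<bar>"
    and "\<bar>lam $ Max UNIV\<bar> > 0"
    and "leading_eigenvalues (X + E) lamhat"
    and "orthonormal_eigenvectors (X + E) lamhat Uhat"
    and "\<bar>lam $ Max UNIV\<bar> \<ge> 4 * max_row_sum E"
  shows "\<exists>W :: real^'r::{finite,linorder}^'r::{finite,linorder}. orthogonal_matrix W \<and>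
           two_to_inf_norm (Uhat - U ** W)
             \<le> 14 * (max_row_sum E / \<bar>lam $ Max UNIV\<bar>) * two_to_inf_norm U"
proof -
  define \<rho> where "\<rho> = \<bar>lam $ Max UNIV\<bar>"
  define \<epsilon> where "\<epsilon> = max_row_sum E"
  define \<mu> where "\<mu> = \<rho> - \<epsilon>"
  define \<delta> where "\<delta> = \<epsilon> / \<mu>"
  have \<rho>: "0 < \<rho>" "4 * \<epsilon> \<le> \<rho>" using assms(8,11) by (simp_all add: \<rho>_def \<epsilon>_def)
  have \<epsilon>0: "0 \<le> \<epsilon>" by (simp add: \<epsilon>_def max_row_sum_nonneg)
  have \<mu>: "0 < \<mu>" "3 * \<rho> \<le> 4 * \<mu>" using \<rho> by (simp_all add: \<mu>_def)
  have \<delta>0: "0 \<le> \<delta>" using \<epsilon>0 \<mu> by (simp add: \<delta>_def)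
  have \<delta>3: "\<delta> \<le> 1/3" using \<rho> \<mu>(1) by (simp add: \<delta>_def \<mu>_def divide_le_eq)
  have \<delta>\<rho>: "\<delta> \<le> 4/3 * (\<epsilon> / \<rho>)"
  proof -
    have "\<epsilon> / \<mu> \<le> \<epsilon> / (3/4 * \<rho>)" using \<mu> \<rho> \<epsilon>0 by (intro divide_left_mono) auto
    then show ?thesis by (simp add: \<delta>_def)
  qed
  have UU: "transpose U ** U = mat 1" using assms(4) by (simp add: orthonormal_eigenvectors_def)
  have HH: "transpose Uhat ** Uhat = mat 1" using assms(10) by (simp add: orthonormal_eigenvectors_def)
  have nE: "opnorm E \<le> \<epsilon>" unfolding \<epsilon>_def by (rule opnorm_symmetric_le_max_row_sum) (rule assms(2))

  have lamge: "\<rho> \<le> \<bar>lam $ i\<bar>" for i unfolding \<rho>_def by (rule assms(7)) simp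
  \<comment> \<open>\<open>X\<close> stretches the range of \<open>U\<close> by at least \<open>\<rho>\<close>, and \<open>E\<close> costs at most \<open>\<epsilon>\<close>.\<close>
  have below: "\<mu> * norm w \<le> norm ((X + E) *v (U *v w))" for w
  proof -
    have "X *v (U *v w) = U *v (diag_matrix lam *v ((transpose U ** U) *v w))"
      by (subst assms(5)) (simp add: matrix_vector_mul_assoc matrix_mul_assoc)
    then have "norm (X *v (U *v w)) = norm (diag_matrix lam *v w)"
      by (simp add: UU isometry_preserves[OF UU])
    then have "\<rho> * norm w \<le> norm (X *v (U *v w))"
      using diag_matrix_norm_ge[OF lamge] \<rho> by simp
    moreover have "norm (E *v (U *v w)) \<le> \<epsilon> * norm w"
      using opnorm_apply[of E "U *v w"] mult_right_mono[OF nE, of "norm w"]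
      by (simp add: isometry_preserves[OF UU])
    ultimately show ?thesis
      using norm_diff_ineq[of "X *v (U *v w)" "E *v (U *v w)"]
      by (simp add: \<mu>_def matrix_vector_mult_add_rdistrib left_diff_distrib)
  qed
  have "transpose (X + E) = X + E" using assms(1,2) by (simp add: transpose_add)
  then have lamhat: "\<mu> \<le> \<bar>lamhat $ j\<bar>" for j
    using assms(9,10) UU below by (rule leading_eigenvalue_lower_bound)

  define D where "D = diag_matrix (\<chi> i. 1 / lamhat $ i)"
  have nD: "opnorm D \<le> 1 / \<mu>"
    unfolding D_def
    by (rule opnorm_diag_matrix_le) (use lamhat \<mu> in \<open>simp add: frac_le\<close>)
  have "lamhat $ i \<noteq> 0" for i using lamhat[of i] \<mu> by auto
  then have XE: "(X + E) ** Uhat ** D = Uhat"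
    unfolding D_def using assms(10) by (intro eigenvectors_diagonalise)
  define Q where "Q = E ** Uhat ** D"
  define M where "M = transpose U ** Uhat"
  define R where "R = Uhat - U ** M"

  \<comment> \<open>\<open>Uhat = X Uhat D + Q\<close>, and \<open>1 - U U\<^sup>T\<close> kills the first summand because it kills \<open>X\<close>.\<close>
  have R: "R = Q - U ** (transpose U ** Q)"
  proof (subst matrix_eq, intro allI)
    fix x
    let ?z = "X *v (Uhat *v (D *v x))"
    have "Uhat *v x = (X + E) *v (Uhat *v (D *v x))"
      by (subst XE[symmetric]) (simp add: matrix_vector_mul_assoc matrix_mul_assoc)
    then have z: "Uhat *v x = ?z + Q *v x"
      by (simp add: Q_def matrix_vector_mult_add_rdistrib flip: matrix_vector_mul_assoc)
    have "U *v (transpose U *v (X *v y)) = X *v y" for y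
    proof -
      have "U *v (transpose U *v (X *v y)) = (U ** (transpose U ** U) ** diag_matrix lam ** transpose U) *v y"
        by (subst assms(5)) (simp add: matrix_vector_mul_assoc matrix_mul_assoc del: transpose_matrix_vector)
      also have "\<dots> = X *v y" by (subst assms(5)) (simp add: UU)
      finally show ?thesis .
    qed
    then show "R *v x = (Q - U ** (transpose U ** Q)) *v x"
      unfolding R_def M_def
      by (simp add: matrix_vector_mult_diff_rdistrib z matrix_vector_right_distrib
          del: transpose_matrix_vector flip: matrix_vector_mul_assoc)
  qed

  have nU: "opnorm U \<le> 1" "opnorm Uhat \<le> 1" "opnorm (transpose U) \<le> 1"
    using opnorm_isometry_le[OF UU] opnorm_isometry_le[OF HH] opnorm_transpose_le[of U] by auto
  have nQ: "opnorm Q \<le> \<delta>"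
  proof -
    have "opnorm Q \<le> opnorm (E ** Uhat) * opnorm D" unfolding Q_def by (rule opnorm_mult_le)
    also have "\<dots> \<le> (\<epsilon> * 1) * (1 / \<mu>)"
      by (intro mult_mono order_trans[OF opnorm_mult_le] nE nU nD opnorm_nonneg) (use \<epsilon>0 in auto)
    finally show ?thesis by (simp add: \<delta>_def)
  qed
  have nR: "opnorm R \<le> \<delta>"
  proof (rule onorm_le)
    fix x
    have Rx: "R *v x = Q *v x - U *v (transpose U *v (Q *v x))"
      by (simp add: R matrix_vector_mult_diff_rdistrib del: transpose_matrix_vector flip: matrix_vector_mul_assoc)
    have "norm (R *v x) \<le> norm (Q *v x)"
      unfolding Rx norm_le projection_complement_inner[OF UU] by simp
    also have "\<dots> \<le> \<delta> * norm x"
      using opnorm_apply[of Q x] mult_right_mono[OF nQ norm_ge_zero[of x]] by linarith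
    finally show "norm (R *v x) \<le> \<delta> * norm x" .
  qed
  \<comment> \<open>Pythagoras: the cosines \<open>M\<close> miss being orthogonal by the square of the sines \<open>R\<close>.\<close>
  have RR: "mat 1 - transpose M ** M = transpose R ** R"
  proof (subst matrix_eq, intro allI)
    fix x
    have Rv: "R *v z = Uhat *v z - U *v (transpose U *v (Uhat *v z))" for z
      by (simp add: R_def M_def matrix_vector_mult_diff_rdistrib del: transpose_matrix_vector flip: matrix_vector_mul_assoc)
    have "((mat 1 - transpose M ** M) *v x) \<bullet> z = ((transpose R ** R) *v x) \<bullet> z" for z
    proof -
      have "((transpose R ** R) *v x) \<bullet> z = (R *v x) \<bullet> (R *v z)"
        unfolding matrix_vector_mul_assoc[symmetric] by (rule inner_transpose_left)
      also have "\<dots> = x \<bullet> z - (M *v x) \<bullet> (M *v z)"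
        unfolding Rv projection_complement_inner[OF UU] isometry_preserves(1)[OF HH]
        by (simp add: M_def matrix_vector_mul_assoc del: transpose_matrix_vector)
      also have "(M *v x) \<bullet> (M *v z) = (transpose M *v (M *v x)) \<bullet> z"
        by (rule inner_transpose_left[symmetric])
      finally show ?thesis
        by (simp add: matrix_vector_mult_diff_rdistrib inner_diff_left del: transpose_matrix_vector flip: matrix_vector_mul_assoc)
    qed
    then show "(mat 1 - transpose M ** M) *v x = (transpose R ** R) *v x"
      using vector_eq_rdot by blast
  qed
  have nH: "opnorm (mat 1 - transpose M ** M) \<le> \<delta> * \<delta>"
    unfolding RR
    by (rule order_trans[OF opnorm_mult_le])
      (intro mult_mono order_trans[OF opnorm_transpose_le] nR opnorm_nonneg \<delta>0)
  have \<delta>\<delta>: "\<delta> * \<delta> \<le> 1/3 * \<delta>" using \<delta>3 \<delta>0 by (intro mult_right_mono)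
  then have "opnorm (mat 1 - transpose M ** M) \<le> 1/9" using nH \<delta>3 by linarith
  then obtain W where W: "orthogonal_matrix W" "opnorm (M - W) \<le> opnorm (mat 1 - transpose M ** M)"
    by (rule polar_factor_near)

  define m where "m = two_to_inf_norm U"
  define k where "k = two_to_inf_norm Uhat"
  have m0: "0 \<le> m" and k0: "0 \<le> k" by (simp_all add: m_def k_def two_to_inf_nonneg)
  have tQ: "two_to_inf_norm Q \<le> \<delta> * k"
  proof -
    have "two_to_inf_norm Q \<le> two_to_inf_norm (E ** Uhat) * opnorm D"
      unfolding Q_def by (rule two_to_inf_mult_opnorm)
    also have "\<dots> \<le> (\<epsilon> * k) * (1 / \<mu>)"
      unfolding \<epsilon>_def k_def
      by (intro mult_mono two_to_inf_max_row_sum_mult nD opnorm_nonneg mult_nonneg_nonneg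
          max_row_sum_nonneg two_to_inf_nonneg)
    finally show ?thesis by (simp add: \<delta>_def)
  qed
  have "opnorm (transpose U ** Q) \<le> 1 * \<delta>"
    by (rule order_trans[OF opnorm_mult_le]) (intro mult_mono nU nQ opnorm_nonneg zero_le_one)
  then have tPQ: "two_to_inf_norm (U ** (transpose U ** Q)) \<le> m * \<delta>"
    unfolding m_def
    by (intro order_trans[OF two_to_inf_mult_opnorm] mult_left_mono two_to_inf_nonneg) simp
  have tR: "two_to_inf_norm R \<le> \<delta> * k + \<delta> * m"
    using two_to_inf_add_le[of Q "- (U ** (transpose U ** Q))"] tQ tPQ
    by (simp add: R two_to_inf_minus mult.commute)
  have "opnorm M \<le> 1 * 1"
    unfolding M_def by (rule order_trans[OF opnorm_mult_le]) (intro mult_mono nU opnorm_nonneg zero_le_one)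
  then have "two_to_inf_norm (U ** M) \<le> m * 1"
    unfolding m_def
    by (intro order_trans[OF two_to_inf_mult_opnorm] mult_left_mono two_to_inf_nonneg) simp
  \<comment> \<open>The bound on \<open>R\<close> involves \<open>Uhat = R + U M\<close> itself; as \<open>\<delta> \<le> 1/3\<close>, that term can be absorbed.\<close>
  then have "k \<le> \<delta> * k + \<delta> * m + m"
    using two_to_inf_add_le[of R "U ** M"] tR by (simp add: k_def R_def)
  moreover have "\<delta> * k \<le> 1/3 * k" "\<delta> * m \<le> 1/3 * m" by (rule mult_right_mono[OF \<delta>3 k0], rule mult_right_mono[OF \<delta>3 m0])
  ultimately have k2: "k \<le> 2 * m" by simp
  have tMW: "two_to_inf_norm (U ** (M - W)) \<le> m * (\<delta> / 3)"
    unfolding m_def using W(2) nH \<delta>\<delta>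
    by (intro order_trans[OF two_to_inf_mult_opnorm] mult_left_mono two_to_inf_nonneg) simp

  have "R + U ** (M - W) = Uhat - U ** W"
    using matrix_add_ldistrib[of U "M - W" W] by (simp add: R_def algebra_simps)
  then have "two_to_inf_norm (Uhat - U ** W) = two_to_inf_norm (R + U ** (M - W))" by simp
  then have "two_to_inf_norm (Uhat - U ** W) \<le> \<delta> * k + \<delta> * m + m * (\<delta> / 3)"
    using two_to_inf_add_le[of R "U ** (M - W)"] tR tMW by linarith
  also have "\<dots> \<le> \<delta> * (2 * m) + \<delta> * m + m * (\<delta> / 3)"
    using mult_left_mono[OF k2 \<delta>0] by simp
  also have "\<dots> = 10/3 * (\<delta> * m)" by simp
  also have "\<dots> \<le> 10/3 * (4/3 * (\<epsilon> / \<rho>) * m)"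
    using mult_right_mono[OF \<delta>\<rho> m0] by simp
  also have "\<dots> = 40/9 * (\<epsilon> / \<rho> * m)" by simp
  also have "\<dots> \<le> 14 * (\<epsilon> / \<rho> * m)"
    by (intro mult_right_mono mult_nonneg_nonneg divide_nonneg_pos) (use \<epsilon>0 \<rho> m0 in auto)
  finally have "two_to_inf_norm (Uhat - U ** W) \<le> 14 * (\<epsilon> / \<rho>) * m" by simp
  then show ?thesis using W(1) unfolding \<epsilon>_def \<rho>_def m_def by blast
qed

end
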